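(* The language $\textsc{Primes} = \{u \in \{0,1\}^* \mid \mathrm{bin}(u) \text{ is prime}\}$ does not have sublinear alternating online state complexity, i.e. there is no function $f:\mathbb{N}\to\mathbb{N}$ with $f = o(n)$ such that $\textsc{Primes} \in \mathrm{Alt}(f)$.
   Context: For a word $w = w(0)w(1)\cdots w(n-1)\in\{0,1\}^*$, $\mathrm{bin}(w) = \sum_{i=0}^{n-1} w(i)2^i$ (least significant digit on the left). An alternating machine over a finite alphabet $A$ consists of a (possibly infinite) set of states $Q$, an initial state $q_0\in Q$, a transition function $\delta: Q\times A\to\mathcal{B}^+(Q)$ (positive boolean formulae over $Q$) and a set $F\subseteq Q$ of accepting states. For an input word $w$, the acceptance game $\mathcal{G}_{\mathcal{A},w}$ is played by Prover and Verifier: starting in $q_0$, the letters of $w$ are read from left to right; in state $q$ reading letter $a$, the next state is obtained from the formula $\delta(q,a)$, Prover resolving disjunctions and Verifier resolving conjunctions. Prover wins a play if it ends in a state of $F$. The word $w$ is accepted if Prover has a winning strategy; the language recognised is the set of accepted words. For $f:\mathbb{N}\to\mathbb{N}$, a language $L$ is in $\mathrm{Alt}(f)$ if there are an alternating machine recognising $L$ and a constant $C$ such that for all $n\in\mathbb{N}$, the number of states $q$ for which there exists a word $w$ of length at most $n$ with $q$ appearing in the game $\mathcal{G}_{\mathcal{A},w}$ is at most $C\cdot f(n)$. *)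

theory Defs
  imports
    Complex_Main
    "HOL-Library.Landau_Symbols"
    "HOL-Computational_Algebra.Primes"
begin

datatype 'q pos_formula =
    Atom 'q
  | Conj "'q pos_formula" "'q pos_formula"
  | Disj "'q pos_formula" "'q pos_formula"

text \<open>The set of states is the whole type \<open>'q\<close>, which may be infinite.\<close>

record ('q, 'a) alt_machine =
  initial :: 'q
  trans :: "'q \<Rightarrow> 'a \<Rightarrow> 'q pos_formula"
  accepting :: "'q set"

text \<open>A position of the acceptance game consists of the formula that remains to be resolved and
  the part of the input that remains to be read. The machine is in state \<open>q\<close> exactly at the
  positions \<open>(Atom q, v)\<close>.\<close>

type_synonym ('q, 'a) position = "'q pos_formula \<times> 'a list"

inductive move :: "('q, 'a) alt_machine \<Rightarrow> ('q, 'a) position \<Rightarrow> ('q, 'a) position \<Rightarrow> bool"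
  for M :: "('q, 'a) alt_machine" where
  read: "move M (Atom q, a # v) (trans M q a, v)"
| disj_left: "move M (Disj \<phi> \<psi>, v) (\<phi>, v)"
| disj_right: "move M (Disj \<phi> \<psi>, v) (\<psi>, v)"
| conj_left: "move M (Conj \<phi> \<psi>, v) (\<phi>, v)"
| conj_right: "move M (Conj \<phi> \<psi>, v) (\<psi>, v)"

definition prover_position :: "('q, 'a) position \<Rightarrow> bool" where
  "prover_position p \<longleftrightarrow> (\<exists>\<phi> \<psi> v. p = (Disj \<phi> \<psi>, v))"

text \<open>Plays may be partial; the complete ones are those that end in some \<open>(Atom q, [])\<close>.\<close>

definition play :: "('q, 'a) alt_machine \<Rightarrow> 'a list \<Rightarrow> ('q, 'a) position list \<Rightarrow> bool" where
  "play M w \<pi> \<longleftrightarrow> \<pi> \<noteq> [] \<and> hd \<pi> = (Atom (initial M), w) \<and> successively (move M) \<pi>"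

text \<open>A strategy of Prover maps a history to the next position. It has to be legal, since otherwise
  an illegal choice would leave no complete consistent play and win vacuously.\<close>

type_synonym ('q, 'a) strategy = "('q, 'a) position list \<Rightarrow> ('q, 'a) position"

definition prover_strategy ::
  "('q, 'a) alt_machine \<Rightarrow> 'a list \<Rightarrow> ('q, 'a) strategy \<Rightarrow> bool" where
  "prover_strategy M w \<sigma> \<longleftrightarrow>
     (\<forall>\<pi>. play M w \<pi> \<and> prover_position (last \<pi>) \<longrightarrow> move M (last \<pi>) (\<sigma> \<pi>))"

definition consistent :: "('q, 'a) strategy \<Rightarrow> ('q, 'a) position list \<Rightarrow> bool" where
  "consistent \<sigma> \<pi> \<longleftrightarrow>
     (\<forall>i. Suc i < length \<pi> \<and> prover_position (\<pi> ! i) \<longrightarrow> \<pi> ! Suc i = \<sigma> (take (Suc i) \<pi>))"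

definition winning_strategy ::
  "('q, 'a) alt_machine \<Rightarrow> 'a list \<Rightarrow> ('q, 'a) strategy \<Rightarrow> bool" where
  "winning_strategy M w \<sigma> \<longleftrightarrow>
     prover_strategy M w \<sigma> \<and>
     (\<forall>\<pi> q. play M w \<pi> \<and> consistent \<sigma> \<pi> \<and> last \<pi> = (Atom q, []) \<longrightarrow> q \<in> accepting M)"

definition language :: "('q, 'a) alt_machine \<Rightarrow> 'a list set" where
  "language M = {w. \<exists>\<sigma>. winning_strategy M w \<sigma>}"

definition appears :: "('q, 'a) alt_machine \<Rightarrow> 'a list \<Rightarrow> 'q \<Rightarrow> bool" where
  "appears M w q \<longleftrightarrow> (\<exists>\<pi> v. play M w \<pi> \<and> last \<pi> = (Atom q, v))"

definition states_upto :: "('q, 'a) alt_machine \<Rightarrow> nat \<Rightarrow> 'q set" where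
  "states_upto M n = {q. \<exists>w. length w \<le> n \<and> appears M w q}"

text \<open>The class of languages depends on the type from which states are drawn, hence the type
  argument.\<close>

definition Alt :: "'q itself \<Rightarrow> (nat \<Rightarrow> nat) \<Rightarrow> 'a::finite list set set" where
  "Alt _ f =
     {L. \<exists>(M :: ('q, 'a) alt_machine) (C :: real). language M = L \<and>
        (\<forall>n. finite (states_upto M n) \<and> real (card (states_upto M n)) \<le> C * real (f n))}"

text \<open>Binary words have letters in \<^typ>\<open>bool\<close>, with \<^const>\<open>True\<close> for the digit 1.\<close>

definition bin :: "bool list \<Rightarrow> nat" where
  "bin w = (\<Sum>i<length w. of_bool (w ! i) * 2 ^ i)"

definition PRIMES :: "bool list set" where
  "PRIMES = {u. prime (bin u)}"

end

theory Submission
  imports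
    Defs
    "HOL-Library.FuncSet"
    "HOL-Real_Asymp.Real_Asymp"
    "HOL-Number_Theory.Cong"
begin

text \<open>Whether \<open>u v\<close> with \<open>|u| \<le> n\<close> is accepted depends only on \<open>u\<close> and on the set of those among
  the \<open>k\<close> states reachable within \<open>n\<close> letters that accept \<open>v\<close>. With \<open>N = 2\<^sup>n\<close> the patterns
  \<open>{u < N. u + N v prime}\<close>, for varying \<open>v\<close>, therefore take at most \<open>2\<^sup>k\<close> values, and it suffices to
  show that their number \<open>K\<close> is at least a fixed power of \<open>N\<close> for large \<open>n\<close>.

  Suppose \<open>K\<close> is small and let \<open>Y\<close> be a product of \<open>m\<close> odd primes up to \<open>N\<close>, where \<open>m\<close> is a small
  power of \<open>N\<close>. By Chebyshev's lower bound there are many primes \<open>u + N v\<close> with \<open>1 \<le> v < Y\<close>, so some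
  pattern \<open>P\<close> accounts for at least one \<open>K\<close>-th of them. A Chebyshev-type upper bound for the primes in
  each residue class modulo \<open>N\<close> shows that \<open>P\<close> has at least \<open>N / K\<close> elements, up to powers of \<open>log N\<close>. But then \<open>P\<close> occupies a
  proportion of about \<open>1 / K\<close> of the residues modulo every prime factor \<open>p\<close> of \<open>Y\<close>, and each of them
  excludes a residue of \<open>v\<close> modulo \<open>p\<close>. By the Chinese remainder theorem hardly any \<open>v < Y\<close> has
  pattern \<open>P\<close>, a contradiction.\<close>

section \<open>Acceptance games\<close>

fun sat :: "'q set \<Rightarrow> 'q pos_formula \<Rightarrow> bool" where
  "sat S (Atom q) \<longleftrightarrow> q \<in> S"
| "sat S (Conj \<phi> \<psi>) \<longleftrightarrow> sat S \<phi> \<and> sat S \<psi>"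
| "sat S (Disj \<phi> \<psi>) \<longleftrightarrow> sat S \<phi> \<or> sat S \<psi>"

fun accepting_from :: "('q, 'a) alt_machine \<Rightarrow> 'a list \<Rightarrow> 'q set" where
  "accepting_from M [] = accepting M"
| "accepting_from M (a # v) = {q. sat (accepting_from M v) (trans M q a)}"

definition winning_position :: "('q, 'a) alt_machine \<Rightarrow> ('q, 'a) position \<Rightarrow> bool" where
  "winning_position M p \<longleftrightarrow> sat (accepting_from M (snd p)) (fst p)"

section \<open>Plays and determinacy of the acceptance game\<close>

lemma play_snoc:
  assumes "play M w \<pi>" "move M (last \<pi>) x"
  shows "play M w (\<pi> @ [x])"
  using assms by (auto simp: play_def successively_append_iff)

lemma play_butlast:
  assumes "play M w (\<pi> @ [x])" "\<pi> \<noteq> []"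
  shows "play M w \<pi>" "move M (last \<pi>) x"
  using assms by (auto simp: play_def successively_append_iff)

lemma consistent_snoc:
  assumes "\<pi> \<noteq> []"
  shows "consistent \<sigma> (\<pi> @ [x]) \<longleftrightarrow>
    consistent \<sigma> \<pi> \<and> (prover_position (last \<pi>) \<longrightarrow> x = \<sigma> \<pi>)" (is "?l \<longleftrightarrow> ?r")
proof
  assume l: ?l
  have "consistent \<sigma> \<pi>"
    unfolding consistent_def
  proof (intro allI impI)
    fix i assume i: "Suc i < length \<pi> \<and> prover_position (\<pi> ! i)"
    then show "\<pi> ! Suc i = \<sigma> (take (Suc i) \<pi>)"
      using l[unfolded consistent_def, rule_format, of i] by (auto simp: nth_append)
  qed
  moreover have "x = \<sigma> \<pi>" if "prover_position (last \<pi>)"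
    using l[unfolded consistent_def, rule_format, of "length \<pi> - 1"] that assms
    by (auto simp: nth_append last_conv_nth)
  ultimately show ?r by blast
next
  assume r: ?r
  show ?l
    unfolding consistent_def
  proof (intro allI impI)
    fix i assume i: "Suc i < length (\<pi> @ [x]) \<and> prover_position ((\<pi> @ [x]) ! i)"
    show "(\<pi> @ [x]) ! Suc i = \<sigma> (take (Suc i) (\<pi> @ [x]))"
    proof (cases "Suc i < length \<pi>")
      case True
      then show ?thesis
        using i r[THEN conjunct1, unfolded consistent_def, rule_format, of i]
        by (auto simp: nth_append)
    next
      case False
      then have "i = length \<pi> - 1" "Suc i = length \<pi>" using i assms by auto
      then show ?thesis using i r assms by (auto simp: nth_append last_conv_nth)
    qed
  qed
qed

lemma consistent_single: "consistent \<sigma> [p]"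
  by (simp add: consistent_def)

lemma play_single: "play M w [(Atom (initial M), w)]"
  by (simp add: play_def)

lemma winning_position_move:
  assumes "winning_position M p" "move M p p'" "\<not> prover_position p"
  shows "winning_position M p'"
  using assms(2,1,3) by cases (auto simp: winning_position_def prover_position_def)

lemma losing_position_move:
  assumes "\<not> winning_position M p" "move M p p'" "prover_position p"
  shows "\<not> winning_position M p'"
  using assms(2,1,3) by cases (auto simp: winning_position_def prover_position_def)

fun greedy :: "('q, 'a) alt_machine \<Rightarrow> ('q, 'a) position \<Rightarrow> ('q, 'a) position" where
  "greedy M (Disj \<phi> \<psi>, v) = (if winning_position M (\<phi>, v) then \<phi> else \<psi>, v)"
| "greedy M p = p"

text \<open>The positional strategy \<open>greedy\<close> picks a winning disjunct whenever there is
  one, and no other move leaves the winning positions. Every consistent play therefore stays winning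
  up to its end.\<close>

lemma winning_position_imp_language:
  assumes "winning_position M (Atom (initial M), w)"
  shows "w \<in> language M"
proof -
  define \<sigma> where "\<sigma> = (\<lambda>\<pi>. greedy M (last \<pi>))"
  have legal: "prover_strategy M w \<sigma>"
    unfolding prover_strategy_def \<sigma>_def
    by (auto simp: prover_position_def intro: move.intros)
  have inv: "winning_position M (last \<pi>)" if "play M w \<pi>" "consistent \<sigma> \<pi>" for \<pi>
    using that
  proof (induction \<pi> rule: rev_induct)
    case Nil
    then show ?case by (simp add: play_def)
  next
    case (snoc x \<pi>)
    show ?case
    proof (cases "\<pi> = []")
      case True
      then show ?thesis using snoc.prems assms by (simp add: play_def)
    next
      case False
      have IH: "winning_position M (last \<pi>)" and mv: "move M (last \<pi>) x"
        and pr: "prover_position (last \<pi>) \<longrightarrow> x = greedy M (last \<pi>)"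
        using snoc False play_butlast[OF snoc.prems(1) False] consistent_snoc[OF False]
        by (auto simp: \<sigma>_def)
      show ?thesis
      proof (cases "prover_position (last \<pi>)")
        case True
        then show ?thesis using IH pr by (auto simp: prover_position_def winning_position_def)
      next
        case False
        then show ?thesis using winning_position_move[OF IH mv] by simp
      qed
    qed
  qed
  have "winning_strategy M w \<sigma>"
    unfolding winning_strategy_def using legal inv
    by (fastforce simp: winning_position_def)
  then show ?thesis by (auto simp: language_def)
qed

text \<open>Each move either consumes a letter or passes to a proper subformula with the same
  remaining word, so a lexicographic induction on word and formula applies. It expresses that all
  plays terminate.\<close>

lemma move_induct:
  assumes step: "\<And>p. (\<And>p'. move M p p' \<Longrightarrow> P p') \<Longrightarrow> P p"
  shows "P p"
proof -
  have "P (\<phi>, v)" for \<phi> v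
  proof (induction v arbitrary: \<phi>)
    case Nil
    show ?case by (induction \<phi>) (rule step, erule move.cases, auto)+
  next
    case (Cons a v)
    show ?case by (induction \<phi>) (rule step, erule move.cases, auto simp: Cons)+
  qed
  then show ?thesis by (cases p) simp
qed

text \<open>Verifier's counterplay: every legal choice of Prover in a losing position stays losing,
  and a losing conjunction has a losing conjunct. Termination then leads to a rejecting end.\<close>

lemma losing_play_extends:
  assumes legal: "prover_strategy M w \<sigma>"
    and "play M w \<pi>" "consistent \<sigma> \<pi>" "last \<pi> = p" "\<not> winning_position M p"
  shows "\<exists>\<pi> q. play M w \<pi> \<and> consistent \<sigma> \<pi> \<and> last \<pi> = (Atom q, []) \<and> q \<notin> accepting M"
  using assms(2-)
proof (induction p arbitrary: \<pi> rule: move_induct[where M = M])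
  case (1 p)
  have ne: "\<pi> \<noteq> []" using 1 by (simp add: play_def)
  have ?case if "move M p p'" "prover_position p \<longrightarrow> p' = \<sigma> \<pi>" "\<not> winning_position M p'" for p'
    using 1(1)[OF that(1), of "\<pi> @ [p']"] 1(2-) that ne
    by (auto simp: consistent_snoc intro: play_snoc)
  note continue = this
  obtain \<phi> v where p: "p = (\<phi>, v)" by (cases p)
  show ?case
  proof (cases \<phi>)
    case (Atom q)
    show ?thesis
    proof (cases v)
      case Nil
      then show ?thesis using 1(2-) Atom p by (auto simp: winning_position_def)
    next
      case (Cons a v')
      then show ?thesis using continue[of "(trans M q a, v')"] 1(5) Atom p
        by (auto simp: winning_position_def prover_position_def intro: move.intros)
    qed
  next
    case (Conj \<psi> \<chi>)
    then show ?thesis using continue[of "(\<psi>, v)"] continue[of "(\<chi>, v)"] 1(5) p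
      by (auto simp: winning_position_def prover_position_def intro: move.intros)
  next
    case (Disj \<psi> \<chi>)
    then have pp: "prover_position p" using p by (simp add: prover_position_def)
    then have mv: "move M p (\<sigma> \<pi>)" using legal 1(2,4) by (auto simp: prover_strategy_def)
    then show ?thesis using continue[of "\<sigma> \<pi>"] losing_position_move[OF 1(5) mv pp] by blast
  qed
qed

lemma language_iff: "w \<in> language M \<longleftrightarrow> initial M \<in> accepting_from M w"
proof
  assume "w \<in> language M"
  then obtain \<sigma> where \<sigma>: "winning_strategy M w \<sigma>" by (auto simp: language_def)
  show "initial M \<in> accepting_from M w"
  proof (rule ccontr)
    assume "initial M \<notin> accepting_from M w"
    then have "\<not> winning_position M (Atom (initial M), w)" by (simp add: winning_position_def)
    then show False
      using losing_play_extends[of M w \<sigma> "[(Atom (initial M), w)]"] \<sigma>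
      by (fastforce simp: winning_strategy_def play_single consistent_single)
  qed
next
  assume "initial M \<in> accepting_from M w"
  then show "w \<in> language M"
    by (intro winning_position_imp_language) (simp add: winning_position_def)
qed

section \<open>Counting left quotients by reachable states\<close>

text \<open>The play runs on the prefix \<open>w\<close> alone, and the suffix enters only through
  the evaluation. Once the prefix is used up, the state reached lies in
  \<open>states_upto M n\<close>, where both suffixes have the same accepting states.\<close>

lemma sat_append_cong:
  assumes eq: "accepting_from M v \<inter> states_upto M n = accepting_from M v' \<inter> states_upto M n"
    and len: "length w \<le> n"
    and "play M w \<pi>" "last \<pi> = p"
  shows "sat (accepting_from M (snd p @ v)) (fst p) \<longleftrightarrow> sat (accepting_from M (snd p @ v')) (fst p)"
  using assms(3-)
proof (induction p arbitrary: \<pi> rule: move_induct[where M = M])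
  case (1 p)
  have IH: "sat (accepting_from M (snd p' @ v)) (fst p') \<longleftrightarrow>
      sat (accepting_from M (snd p' @ v')) (fst p')" if "move M p p'" for p'
    using 1(1)[OF that, of "\<pi> @ [p']"] 1(2-) that by (auto intro: play_snoc)
  obtain \<phi> u where p: "p = (\<phi>, u)" by (cases p)
  show ?case
  proof (cases \<phi>)
    case (Atom q)
    show ?thesis
    proof (cases u)
      case Nil
      then have "q \<in> states_upto M n"
        using 1(2-) Atom p len by (auto simp: states_upto_def appears_def)
      then show ?thesis using eq Atom Nil p by auto
    next
      case (Cons a u')
      then show ?thesis using IH[of "(trans M q a, u')"] Atom p by (auto intro: move.intros)
    qed
  next
    case (Conj \<psi> \<chi>)
    then show ?thesis using IH[of "(\<psi>, u)"] IH[of "(\<chi>, u)"] p by (auto intro: move.intros)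
  next
    case (Disj \<psi> \<chi>)
    then show ?thesis using IH[of "(\<psi>, u)"] IH[of "(\<chi>, u)"] p by (auto intro: move.intros)
  qed
qed

lemma language_append_cong:
  assumes "accepting_from M v \<inter> states_upto M n = accepting_from M v' \<inter> states_upto M n"
    and "length u \<le> n"
  shows "u @ v \<in> language M \<longleftrightarrow> u @ v' \<in> language M"
  using sat_append_cong[OF assms play_single refl] by (simp add: language_iff)

lemma card_left_quotients_le:
  assumes fin: "finite (states_upto M n)"
  shows "finite (range (\<lambda>v. {u. length u \<le> n \<and> u @ v \<in> language M}))"
    and "card (range (\<lambda>v. {u. length u \<le> n \<and> u @ v \<in> language M})) \<le> 2 ^ card (states_upto M n)"
proof -
  let ?c = "\<lambda>v. {u. length u \<le> n \<and> u @ v \<in> language M}"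
  let ?s = "\<lambda>v. accepting_from M v \<inter> states_upto M n"
  \<comment> \<open>The quotient is recovered from a set of states through an arbitrary suffix
    inducing that set; by \<open>language_append_cong\<close> the choice does not matter.\<close>
  define g where "g S = ?c (SOME v. ?s v = S)" for S
  have "?c v = g (?s v)" for v
  proof -
    have "?s (SOME v'. ?s v' = ?s v) = ?s v" by (rule someI[where x = v]) simp
    then show ?thesis unfolding g_def by (intro Collect_cong) (metis language_append_cong)
  qed
  then have sub: "range ?c \<subseteq> g ` Pow (states_upto M n)" by auto
  then show "finite (range ?c)" using fin by (meson finite_Pow_iff finite_imageI finite_subset)
  have "card (range ?c) \<le> card (g ` Pow (states_upto M n))"
    using sub fin by (intro card_mono) auto
  also have "\<dots> \<le> card (Pow (states_upto M n))" using fin by (intro card_image_le) auto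
  finally show "card (range ?c) \<le> 2 ^ card (states_upto M n)" using fin by (simp add: card_Pow)
qed

section \<open>Patterns of primes\<close>

lemma bin_Nil: "bin [] = 0"
  by (simp add: bin_def)

lemma bin_Cons: "bin (b # w) = of_bool b + 2 * bin w"
  by (simp add: bin_def sum.lessThan_Suc_shift sum_distrib_left mult.left_commute
      del: sum.lessThan_Suc sum_of_bool_mult_eq)

lemma bin_append: "bin (u @ v) = bin u + 2 ^ length u * bin v"
  by (induction u) (auto simp: bin_Nil bin_Cons algebra_simps)

lemma ex_bin_length:
  assumes "x < 2 ^ n"
  shows "\<exists>u. length u = n \<and> bin u = x"
  using assms
proof (induction n arbitrary: x)
  case 0
  then show ?case by (auto simp: bin_Nil)
next
  case (Suc n)
  have "x div 2 < 2 ^ n" using Suc.prems by auto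
  then obtain u where "length u = n" "bin u = x div 2" using Suc.IH by blast
  then have "length (odd x # u) = Suc n \<and> bin (odd x # u) = x"
    by (auto simp: bin_Cons)
  then show ?case by blast
qed

lemma bin_less: "bin w < 2 ^ length w"
  by (induction w) (auto simp: bin_Nil bin_Cons)

definition pattern :: "nat \<Rightarrow> nat \<Rightarrow> nat set" where
  "pattern N v = {u. u < N \<and> prime (u + N * v)}"

text \<open>With the least significant digit first, appending \<open>v\<close> to a word of length
  \<open>n\<close> adds \<open>2^n * bin v\<close> to its value. A pattern is thus the image under
  \<open>bin\<close> of the words of length exactly \<open>n\<close> in a left quotient.\<close>

lemma card_patterns_le:
  assumes "language M = PRIMES" "finite (states_upto M n)"
  shows "card (range (pattern (2 ^ n))) \<le> 2 ^ card (states_upto M n)"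
proof -
  let ?c = "\<lambda>v. {u. length u \<le> n \<and> u @ v \<in> language M}"
  define g where "g X = bin ` (X \<inter> {u. length u = n})" for X
  have "pattern (2 ^ n) y \<in> g ` range ?c" for y
  proof -
    \<comment> \<open>Since \<open>y < 2^y\<close>, a word of length \<open>y\<close>
      suffices.\<close>
    obtain v where v: "bin v = y"
      using ex_bin_length[of y y] less_exp by blast
    have "pattern (2 ^ n) y = g (?c v)"
    proof (rule set_eqI, rule iffI)
      fix x assume x: "x \<in> pattern (2 ^ n) y"
      then obtain u where u: "length u = n" "bin u = x"
        using ex_bin_length by (auto simp: pattern_def)
      then show "x \<in> g (?c v)"
        using x v assms(1) by (auto simp: pattern_def g_def PRIMES_def bin_append image_iff)
    next
      fix x assume "x \<in> g (?c v)"
      then show "x \<in> pattern (2 ^ n) y"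
        using v assms(1) bin_less by (auto simp: pattern_def g_def PRIMES_def bin_append)
    qed
    then show ?thesis by blast
  qed
  then have "range (pattern (2 ^ n)) \<subseteq> g ` range ?c" by auto
  then have "card (range (pattern (2 ^ n))) \<le> card (g ` range ?c)"
    using card_left_quotients_le(1)[OF assms(2)] by (intro card_mono) auto
  also have "\<dots> \<le> card (range ?c)"
    using card_left_quotients_le(1)[OF assms(2)] by (rule card_image_le)
  also have "\<dots> \<le> 2 ^ card (states_upto M n)" by (rule card_left_quotients_le(2)[OF assms(2)])
  finally show ?thesis .
qed

section \<open>Chebyshev bounds\<close>

text \<open>The equation says \<open>1/c = 1/a - 1/b\<close>, so \<open>l/c\<close> is a difference
  of the two integers \<open>l/a\<close> and \<open>l/b\<close>.\<close>

lemma dvd_if_reciprocal_diff: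
  fixes a b c l :: nat
  assumes "a dvd l" "b dvd l" "a * b + c * a = c * b" "a > 0" "b > 0"
  shows "c dvd l"
proof -
  obtain x y where x: "l = a * x" and y: "l = b * y" using assms(1,2) by (meson dvdE)
  have "int a * int b * (int c * (int x - int y)) = int c * (int b * (int a * int x) - int a * (int b * int y))"
    by (simp add: algebra_simps)
  also have "\<dots> = int l * (int c * int b - int c * int a)"
    using x y by (simp add: algebra_simps flip: of_nat_mult)
  also have "\<dots> = int a * int b * int l"
  proof -
    have "int c * int b = int a * int b + int c * int a" by (metis assms(3) of_nat_add of_nat_mult)
    then show ?thesis by simp
  qed
  finally have "int c * (int x - int y) = int l" using assms(4,5) by simp
  then have "int c dvd int l" by (metis dvd_triv_left)
  then show ?thesis by simp
qed

text \<open>This is the recurrence of Leibniz's harmonic triangle. For \<open>n = m + 1\<close>, the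
  reciprocal of \<open>Suc k * (n choose Suc k) = n * (m choose k)\<close> is the difference of the
  reciprocals of \<open>k * (m choose k)\<close> and \<open>k * (n choose k)\<close>.\<close>

lemma mult_binomial_dvd_Lcm:
  assumes "1 \<le> k" "k \<le> n"
  shows "k * (n choose k) dvd Lcm {1..n::nat}"
  using assms
proof (induction k arbitrary: n rule: nat_induct_at_least)
  case base
  then show ?case by simp
next
  case (Suc k)
  then obtain m where n: "n = Suc m" and km: "k \<le> m" by (cases n) auto
  let ?L = "Lcm {1..n}"
  have a: "k * (m choose k) dvd ?L"
    using Suc.IH[OF km] n by (meson Lcm_subset dvd_trans atLeastatMost_subset_iff le_SucI order_refl)
  have b: "k * (n choose k) dvd ?L" using Suc.IH[of n] Suc.prems by simp
  have c: "Suc k * (n choose Suc k) = n * (m choose k)"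
    using Suc_times_binomial_eq[of m k] n by (simp add: mult.commute)
  have d: "(n - k) * (n choose k) = n * (m choose k)"
    using binomial_absorb_comp[of n k] n by simp
  have "k * (m choose k) * (k * (n choose k)) + n * (m choose k) * (k * (m choose k))
      = k * (m choose k) * ((k + (n - k)) * (n choose k))"
    by (simp add: algebra_simps flip: d)
  also have "\<dots> = n * (m choose k) * (k * (n choose k))"
    using n km by (simp add: algebra_simps)
  finally have "n * (m choose k) dvd ?L"
    by (rule dvd_if_reciprocal_diff[OF a b]) (use Suc.hyps km n in auto)
  then show ?case unfolding c .
qed

text \<open>The multiplicity of a prime in a least common multiple is a maximum, hence attained by
  some element. Zeros are treated apart, being divisible by every prime power.\<close>

lemma prime_power_dvd_Lcm:
  fixes p :: nat
  assumes "prime p" "finite S" "p ^ a dvd Lcm S" "a > 0"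
  shows "\<exists>x\<in>S. p ^ a dvd x"
  using assms(2,3)
proof (induction S rule: finite_induct)
  case empty
  then show ?case using assms by (auto simp: prime_nat_iff)
next
  case (insert x S)
  show ?case
  proof (cases "x = 0 \<or> Lcm S = 0")
    case True
    then show ?thesis
    proof
      assume "Lcm S = 0"
      then show ?thesis using insert by auto
    qed auto
  next
    case False
    have "p ^ a dvd lcm x (Lcm S)" using insert by simp
    then have "a \<le> multiplicity p (lcm x (Lcm S))"
      using False assms(1) by (intro multiplicity_geI) (auto simp: lcm_eq_0_iff)
    also have "\<dots> = max (multiplicity p x) (multiplicity p (Lcm S))"
      using False by (intro multiplicity_lcm assms(1)) auto
    finally have "p ^ a dvd x \<or> p ^ a dvd Lcm S" by (auto intro: multiplicity_dvd' simp: max_def split: if_splits)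
    then show ?thesis using insert by auto
  qed
qed

text \<open>The bound holds because every prime power dividing the central binomial coefficient is at most
  \<open>2 h\<close>.\<close>

lemma two_power_le_power_card_primes:
  assumes "h > 0"
  shows "2 ^ h \<le> (2 * h) ^ card {p. prime p \<and> p \<le> 2 * h}"
proof -
  let ?C = "(2 * h) choose h"
  let ?P = "{p::nat. prime p \<and> p \<le> 2 * h}"
  have C0: "?C > 0" by simp
  have "h * ?C dvd Lcm {1..2 * h}"
    using assms by (intro mult_binomial_dvd_Lcm) auto
  then have dvd: "?C dvd Lcm {1..2 * h}" by (rule dvd_mult_right)
  have pp: "p ^ multiplicity p ?C \<le> 2 * h \<and> p \<in> ?P" if p: "p \<in> prime_factors ?C" for p
  proof -
    have pr: "prime p" and m: "multiplicity p ?C > 0"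
      using p by (auto simp: prime_factors_multiplicity)
    have "p ^ multiplicity p ?C dvd Lcm {1..2 * h}" using multiplicity_dvd dvd dvd_trans by blast
    then obtain x where x: "x \<in> {1..2 * h}" "p ^ multiplicity p ?C dvd x"
      using prime_power_dvd_Lcm[OF pr _ _ m] by blast
    then have le: "p ^ multiplicity p ?C \<le> 2 * h" by (auto dest!: dvd_imp_le)
    moreover have "p \<le> p ^ multiplicity p ?C" using m pr by (intro self_le_power) (auto dest: prime_ge_1_nat)
    ultimately show ?thesis using pr by simp
  qed
  have fin: "finite ?P" by simp
  have "?C = (\<Prod>p\<in>prime_factors ?C. p ^ multiplicity p ?C)"
    using C0 by (intro prime_factorization_nat)
  also have "\<dots> \<le> (\<Prod>p\<in>prime_factors ?C. 2 * h)" using pp by (intro prod_mono) auto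
  also have "\<dots> = (2 * h) ^ card (prime_factors ?C)" by simp
  also have "\<dots> \<le> (2 * h) ^ card ?P"
    using pp assms fin by (intro power_increasing card_mono) auto
  finally have ub: "?C \<le> (2 * h) ^ card ?P" .
  \<comment> \<open>This turns the bound \<open>4^h / (2 * h)\<close> for the central binomial
    coefficient into \<open>2^h\<close>.\<close>
  have "2 * h \<le> 2 ^ h"
    using assms
  proof (induction h rule: nat_induct_non_zero)
    case (Suc h)
    then show ?case by (cases h) auto
  qed simp
  then have "2 ^ h * (2 * real h) \<le> 2 ^ h * (2::real) ^ h"
    using assms by (metis mult_left_mono of_nat_le_iff of_nat_mult of_nat_numeral of_nat_power zero_le_numeral zero_le_power)
  also have "\<dots> = 4 ^ h" by (simp flip: power_mult_distrib)
  finally have "2 ^ h \<le> 4 ^ h / (2 * real h)" using assms by (simp add: field_simps)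
  also have "\<dots> \<le> real ?C" by (rule central_binomial_lower_bound[OF assms])
  finally have "real (2 ^ h) \<le> real ?C" by simp
  then have "2 ^ h \<le> ?C" by (simp only: of_nat_le_iff)
  then show ?thesis using ub by simp
qed

section \<open>Upper bound for primes in a residue class modulo a power of two\<close>

text \<open>Halving the argument works because \<open>fact (2 * j)\<close> is
  \<open>2^j * fact j\<close> times the product of the odd numbers below \<open>2 * j\<close>. The
  odd part \<open>q\<close> is coprime to powers of two, and passing to it loses a factor of at most
  \<open>2^m\<close>.\<close>

lemma fact_eq_odd_times_power_two:
  "\<exists>a q :: nat. fact m = 2 ^ a * q \<and> odd q \<and> a \<le> m"
proof (induction m rule: less_induct)
  case (less m)
  have ev: "\<exists>q::nat. fact (2 * j) = 2 ^ j * fact j * q \<and> odd q" for j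
  proof (induction j)
    case (Suc j)
    then obtain q :: nat where "fact (2 * j) = 2 ^ j * fact j * q" "odd q" by blast
    then have "fact (2 * Suc j) = 2 ^ Suc j * fact (Suc j) * ((2 * j + 1) * q) \<and> odd ((2 * j + 1) * q)"
      by (simp add: algebra_simps)
    then show ?case by blast
  qed simp
  show ?case
  proof (cases "m < 2")
    case True
    then have "fact m = 2 ^ 0 * (1::nat)" by (cases m) auto
    then show ?thesis by (metis odd_one zero_le)
  next
    case False
    define j where "j = m div 2"
    have "j < m" using False by (auto simp: j_def)
    then obtain a q :: nat where aq: "fact j = 2 ^ a * q" "odd q" "a \<le> j" using less by blast
    obtain q' :: nat where q': "fact (2 * j) = 2 ^ j * fact j * q'" "odd q'" using ev by blast
    have e: "(fact (2 * j) :: nat) = 2 ^ (j + a) * (q * q')" using aq q' by (simp add: power_add algebra_simps)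
    show ?thesis
    proof (cases "even m")
      case True
      then have "m = 2 * j" by (auto simp: j_def)
      then show ?thesis using e aq q' by (intro exI[of _ "j + a"] exI[of _ "q * q'"]) auto
    next
      case False
      then have m: "m = Suc (2 * j)" by (auto simp: j_def elim: oddE)
      then have "(fact m :: nat) = 2 ^ (j + a) * (m * (q * q'))" using e by (simp add: algebra_simps)
      then show ?thesis using aq q' m False
        by (intro exI[of _ "j + a"] exI[of _ "m * (q * q')"]) auto
    qed
  qed
qed

text \<open>Since \<open>N\<close> is invertible modulo \<open>q\<close>, the product is, up to a unit modulo \<open>q\<close>, a product of
  \<open>m\<close> consecutive integers.\<close>

lemma coprime_dvd_fact_imp_dvd_prod:
  fixes u N :: nat
  assumes "coprime N q" "q dvd fact m"
  shows "q dvd (\<Prod>k=1..m. u + N * k)"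
proof -
  \<comment> \<open>Multiplication by the inverse \<open>x\<close> of \<open>N\<close> turns each
    factor \<open>u + N * k\<close> into \<open>u * x + k\<close> modulo \<open>q\<close>.\<close>
  obtain x where x: "[N * x = 1] (mod q)" using cong_solve_coprime_nat[OF assms(1)] by auto
  have "(\<Prod>k=1..m. u * x + k) = pochhammer (u * x + 1) m"
    unfolding pochhammer_prod
    by (rule prod.reindex_bij_witness[of _ Suc "\<lambda>k. k - 1"]) auto
  moreover have "fact m dvd pochhammer (u * x + 1) m"
    using fact_dvd_pochhammer[of m "int (u * x + 1)"]
    by (metis of_nat_dvd_iff of_nat_fact pochhammer_of_nat)
  ultimately have "q dvd (\<Prod>k=1..m. u * x + k)" using assms(2) dvd_trans by metis
  moreover have "[(\<Prod>k=1..m. x * (u + N * k)) = (\<Prod>k=1..m. u * x + k)] (mod q)"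
  proof (rule cong_prod)
    fix k
    have "[x * u + (N * x) * k = x * u + 1 * k] (mod q)" using x by (intro cong_add cong_mult cong_refl)
    then show "[x * (u + N * k) = u * x + k] (mod q)" by (simp add: algebra_simps)
  qed
  ultimately have "q dvd (\<Prod>k=1..m. x * (u + N * k))" using cong_dvd_iff by blast
  then have "q dvd x ^ m * (\<Prod>k=1..m. u + N * k)" by (simp add: prod.distrib)
  moreover have "coprime q (x ^ m)"
    using x by (metis cong_imp_coprime coprime_1_left coprime_commute coprime_mult_left_iff cong_sym coprime_power_left_iff)
  ultimately show ?thesis by (simp add: coprime_dvd_mult_right_iff)
qed

lemma prod_primes_dvd:
  fixes g :: nat
  assumes "finite A" "\<And>p. p \<in> A \<Longrightarrow> prime p \<and> p dvd g"
  shows "\<Prod>A dvd g"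
  using assms
proof (induction A rule: finite_induct)
  case (insert p A)
  have "coprime p (\<Prod>A)"
    using insert by (intro prod_coprime_right) (metis insertCI primes_coprime)
  then show ?case using insert by (simp add: divides_mult)
qed simp

text \<open>Chebyshev's argument, with the binomial coefficient replaced by the product
  \<open>F\<close> of the terms \<open>u + N * k\<close> divided by the odd part \<open>q\<close> of
  \<open>fact m\<close>. The primes counted divide \<open>F\<close>, but being larger than
  \<open>Y\<close> they do not divide \<open>fact m\<close>. Their product therefore divides
  \<open>G = F / q\<close>, which is at most \<open>(4 * N)^Y\<close>.\<close>

lemma card_primes_progression:
  fixes u n Y :: nat
  defines "N \<equiv> 2 ^ n"
  assumes u: "u < N" and Y: "Y > 0"
  shows "Y ^ card {v. 1 \<le> v \<and> v < Y \<and> prime (u + N * v) \<and> u + N * v > Y} \<le> (4 * N) ^ Y"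
proof -
  let ?T = "{v. 1 \<le> v \<and> v < Y \<and> prime (u + N * v) \<and> u + N * v > Y}"
  let ?f = "\<lambda>v. u + N * v"
  define m where "m = Y - 1"
  have Ym: "Y = Suc m" using Y by (simp add: m_def)
  have N0: "N > 0" by (simp add: N_def)
  obtain a q :: nat where aq: "fact m = 2 ^ a * q" "odd q" "a \<le> m" using fact_eq_odd_times_power_two by blast
  define F where "F = (\<Prod>k=1..m. ?f k)"
  have "q dvd F" unfolding F_def using aq
    by (intro coprime_dvd_fact_imp_dvd_prod) (auto simp: N_def)
  then obtain G where G: "F = q * G" by blast
  have F0: "F > 0" unfolding F_def using N0 by (intro prod_pos) auto
  have fin: "finite ?T" by (rule finite_subset[of _ "{..<Y}"]) auto
  have inj: "inj_on ?f ?T" using N0 by (auto intro: inj_onI)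
  have "\<Prod>(?f ` ?T) dvd G"
  proof (rule prod_primes_dvd)
    fix p assume "p \<in> ?f ` ?T"
    then obtain v where v: "v \<in> ?T" "p = ?f v" by blast
    then have p: "prime p" "p > Y" by auto
    have "?f v dvd F" unfolding F_def using v Ym by (intro dvd_prodI) auto
    then have "p dvd F" using v by simp
    moreover have "\<not> p dvd q"
    proof
      assume "p dvd q"
      then have "p dvd fact m" using aq by simp
      then show False using p Ym prime_dvd_fact_iff[of p m] by simp
    qed
    ultimately show "prime p \<and> p dvd G" using p G by (simp add: prime_dvd_mult_iff)
  qed (use fin in simp)
  moreover have "G > 0" using F0 unfolding G by simp
  ultimately have le: "(\<Prod>v\<in>?T. ?f v) \<le> G"
    using inj by (simp add: prod.reindex dvd_imp_le)
  have "Y ^ card ?T = (\<Prod>v\<in>?T. Y)" by simp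
  also have "\<dots> \<le> (\<Prod>v\<in>?T. ?f v)" by (intro prod_mono) auto
  also note le
  finally have YG: "Y ^ card ?T \<le> G" .
  \<comment> \<open>As \<open>u < N\<close>, each term is at most \<open>N * Suc k\<close>; the
    numbers \<open>Suc k\<close> multiply to \<open>fact Y\<close>, and division by \<open>q\<close>
    leaves \<open>Y * 2^a\<close> of it.\<close>
  have "F \<le> (\<Prod>k=1..m. N * Suc k)" unfolding F_def using u by (intro prod_mono) auto
  also have "\<dots> = N ^ m * (\<Prod>k=1..m. Suc k)" by (simp only: prod.distrib) simp
  also have "(\<Prod>k=1..m. Suc k) = fact Y"
    unfolding Ym by (induction m) (auto simp: algebra_simps)
  finally have "F \<le> N ^ m * (Y * fact m)" using Ym by simp
  then have "q * G \<le> q * (N ^ m * Y * 2 ^ a)" using G aq by (simp add: algebra_simps)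
  then have "G \<le> N ^ m * Y * 2 ^ a" using aq(2) by (simp add: odd_pos)
  also have "\<dots> \<le> N ^ Y * 2 ^ Y * 2 ^ Y"
    by (intro mult_mono power_increasing) (use aq N0 Ym less_exp[of Y] in auto)
  also have "\<dots> = (4 * N) ^ Y" by (simp add: power_mult_distrib flip: power_mult_distrib[of 2 2])
  finally show ?thesis using YG by simp
qed

section \<open>Many patterns\<close>

text \<open>A residue class modulo \<open>p\<close> contains at most \<open>N div p + 1\<close>
  numbers below \<open>N\<close>, so \<open>P\<close> meets at least
  \<open>card P * p / (2 * N)\<close> classes. Each class met forbids a different residue of
  \<open>v\<close> modulo \<open>p\<close>, and by the Chinese remainder theorem
  \<open>v < Y\<close> is determined by its residues.\<close>

lemma card_sieve_le:
  fixes Y :: nat and P :: "nat set"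
  assumes fin: "finite A" and A: "\<And>p. p \<in> A \<Longrightarrow> prime p \<and> coprime N p \<and> p \<le> N"
    and P: "P \<subseteq> {..<N}" and Y: "Y = \<Prod>A"
    and S: "S \<subseteq> {1..<Y}" "\<And>v u. v \<in> S \<Longrightarrow> u \<in> P \<Longrightarrow> prime (u + N * v)"
  shows "real (card S) \<le> real Y * (1 - card P / (2 * real N)) ^ card A"
proof -
  define B where "B p = {r. r < p \<and> (\<forall>u\<in>P. \<not> p dvd u + N * r)}" for p
  define h where "h v = restrict (\<lambda>p. v mod p) A" for v :: nat
  have finP: "finite P" using P finite_subset by blast
  have hin: "h v \<in> Pi\<^sub>E A B" if v: "v \<in> S" for v
  proof (rule PiE_I)
    fix p assume p: "p \<in> A"
    then have pr: "prime p" and pN: "p \<le> N" using A by auto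
    have "\<not> p dvd u + N * (v mod p)" if u: "u \<in> P" for u
    proof
      assume "p dvd u + N * (v mod p)"
      moreover have "[u + N * (v mod p) = u + N * v] (mod p)"
        by (intro cong_add cong_mult cong_refl) (simp add: cong_def)
      ultimately have "p dvd u + N * v" using cong_dvd_iff by blast
      \<comment> \<open>A prime divisible by \<open>p\<close> equals \<open>p\<close>. Since
        \<open>v\<close> is positive, \<open>u + N * v\<close> is at least \<open>N\<close>, which
        forces \<open>p = N\<close> against coprimality.\<close>
      then have "p = u + N * v" using S(2)[OF v u] pr by (simp add: primes_dvd_imp_eq)
      moreover have "N * 1 \<le> N * v" using v S by (intro mult_le_mono2) auto
      ultimately have "p = N" using pN by linarith
      then show False using A[OF p] pr by (auto dest: prime_gt_1_nat)
    qed
    then show "h v p \<in> B p" using p pr by (simp add: h_def B_def prime_gt_0_nat)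
  next
    fix p assume "p \<notin> A"
    then show "h v p = undefined" by (simp add: h_def)
  qed
  have inj: "inj_on h S"
  proof (rule inj_onI)
    fix v w assume vw: "v \<in> S" "w \<in> S" "h v = h w"
    have "[v = w] (mod \<Prod>A)"
    proof (rule coprime_cong_prod_nat[where m = "\<lambda>p. p"])
      fix p assume p: "p \<in> A"
      then show "[v = w] (mod p)" using fun_cong[OF vw(3), of p] by (simp add: cong_def h_def)
    next
      fix p q assume "p \<in> A" "q \<in> A" "p \<noteq> q"
      then show "coprime p q" using A primes_coprime by blast
    qed
    moreover have "v < \<Prod>A" "w < \<Prod>A" using vw S Y by auto
    ultimately show "v = w" by (simp add: cong_less_modulus_unique_nat)
  qed
  have cardB: "real (card (B p)) \<le> real p * (1 - card P / (2 * N))" if p: "p \<in> A" for p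
  proof -
    have pr: "prime p" and cop: "coprime N p" and pN: "p \<le> N" using A p by auto
    have p0: "p > 0" and N0: "N > 0" using pr pN by (auto simp: prime_gt_0_nat dest: prime_gt_0_nat)
    obtain x where x: "[N * x = 1] (mod p)" using cong_solve_coprime_nat[OF cop] by auto
    define R where "R = (\<lambda>u. u mod p) ` P"
    have Rp: "R \<subseteq> {..<p}" using p0 by (auto simp: R_def)
    have finR: "finite R" using Rp finite_subset by blast
    \<comment> \<open>The residue of \<open>v\<close> forbidden by \<open>r\<close>: the solution of
      \<open>r + N * v = 0\<close> modulo \<open>p\<close>, where \<open>x\<close> inverts
      \<open>N\<close>.\<close>
    define e where "e r = ((p - r) * x) mod p" for r
    have ee: "[r + N * e r = 0] (mod p)" if r: "r < p" for r
    proof -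
      have "[r + N * e r = r + N * ((p - r) * x)] (mod p)"
        unfolding e_def by (intro cong_add cong_mult cong_refl) (simp add: cong_def)
      also have "r + N * ((p - r) * x) = r + (N * x) * (p - r)" by (simp add: mult_ac)
      also have "[r + (N * x) * (p - r) = r + 1 * (p - r)] (mod p)"
        using x by (intro cong_add cong_mult cong_refl)
      also have "r + 1 * (p - r) = p" using r by simp
      finally show ?thesis by (simp add: cong_def)
    qed
    have injR: "inj_on e R"
    proof (rule inj_onI)
      fix r s assume rs: "r \<in> R" "s \<in> R" "e r = e s"
      then have "r < p" "s < p" using Rp by auto
      then have "[r + N * e r = s + N * e r] (mod p)"
        using ee[of r] ee[of s] rs(3) by (metis cong_sym cong_trans)
      then have "[r = s] (mod p)" by (simp add: cong_add_rcancel_nat)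
      then show "r = s" using \<open>r < p\<close> \<open>s < p\<close> by (simp add: cong_less_modulus_unique_nat)
    qed
    have "B p \<inter> e ` R = {}"
    proof -
      have "e r \<notin> B p" if r: "r \<in> R" for r
      proof -
        obtain u where u: "u \<in> P" "r = u mod p" using r by (auto simp: R_def)
        have "[u + N * e r = r + N * e r] (mod p)" using u by (intro cong_add) (auto simp: cong_def)
        also have "[r + N * e r = 0] (mod p)" using ee r Rp by auto
        finally have "p dvd u + N * e r" by (simp add: cong_0_iff)
        then show ?thesis using u by (auto simp: B_def)
      qed
      then show ?thesis by blast
    qed
    moreover have "B p \<union> e ` R \<subseteq> {..<p}" using p0 by (auto simp: B_def e_def)
    moreover have "finite (B p)" by (simp add: B_def)
    ultimately have BR: "card (B p) + card R \<le> p"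
      using finR injR card_mono[of "{..<p}" "B p \<union> e ` R"]
      by (simp add: card_Un_disjoint card_image)
    \<comment> \<open>Division with remainder by \<open>p\<close> bounds \<open>card P\<close> by
      \<open>Suc (N div p) * card R\<close>; then \<open>p \<le> N\<close> gives
      \<open>Suc (N div p) * p \<le> 2 * N\<close>.\<close>
    have "P \<subseteq> (\<lambda>(d, r). d * p + r) ` ({..N div p} \<times> R)"
    proof
      fix u assume u: "u \<in> P"
      then have "u div p \<le> N div p" using P by (intro div_le_mono) auto
      then have "(u div p, u mod p) \<in> {..N div p} \<times> R" using u by (auto simp: R_def)
      then show "u \<in> (\<lambda>(d, r). d * p + r) ` ({..N div p} \<times> R)"
        by (intro image_eqI[where x = "(u div p, u mod p)"]) auto
    qed
    then have "card P \<le> card ({..N div p} \<times> R)"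
      using finR by (intro surj_card_le) auto
    also have "\<dots> = Suc (N div p) * card R" by (simp add: card_cartesian_product)
    finally have "card P * p \<le> Suc (N div p) * card R * p" by (rule mult_le_mono1)
    also have "\<dots> = (Suc (N div p) * p) * card R" by (simp only: mult_ac)
    also have "\<dots> \<le> (2 * N) * card R"
      using add_mono[OF pN div_times_less_eq_dividend[of N p]] by (intro mult_le_mono1) simp
    finally have "card P * p \<le> 2 * N * card R" .
    then have "real (card P) * p \<le> 2 * N * real (card R)"
      by (metis of_nat_le_iff of_nat_mult of_nat_numeral)
    then have "real p * (card P / (2 * N)) \<le> card R" using N0 by (simp add: field_simps)
    moreover have "real (card (B p)) + card R \<le> p" using BR by linarith
    ultimately show ?thesis by (simp add: algebra_simps)
  qed
  have "card S \<le> card (Pi\<^sub>E A B)"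
    using hin inj fin by (intro card_inj_on_le[of h]) (auto intro!: finite_PiE simp: B_def)
  also have "\<dots> = (\<Prod>p\<in>A. card (B p))" by (rule card_PiE[OF fin])
  finally have "real (card S) \<le> (\<Prod>p\<in>A. real (card (B p)))" by (metis of_nat_le_iff of_nat_prod)
  also have "\<dots> \<le> (\<Prod>p\<in>A. real p * (1 - card P / (2 * N)))"
    using cardB by (intro prod_mono) auto
  also have "\<dots> = real Y * (1 - card P / (2 * N)) ^ card A"
    by (simp add: prod.distrib Y)
  finally show ?thesis by simp
qed

section \<open>Lower bound for the number of patterns\<close>

text \<open>Here \<open>m\<close> is the number of sieving primes. For the most frequent pattern
  \<open>P\<close>, the prime count bounds \<open>card P / N\<close> from below, while sieving shows
  that this density cannot be large unless \<open>K\<close> is. The hypothesis \<open>nm\<close>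
  supplies \<open>m\<close> odd primes up to \<open>N\<close>, and \<open>Nm\<close> ensures
  \<open>N < Y\<close>.\<close>

lemma card_patterns_exp_le:
  fixes n m :: nat
  defines "N \<equiv> 2 ^ n"
  defines "K \<equiv> card (range (pattern N))"
  assumes n: "n > 0" and m: "m > 0" and Nm: "N < 2 ^ m" and nm: "4 * n * (m + 1) \<le> N"
  shows "exp (real m / (16 * real n * (real n + 2) * real K)) \<le> 4 * real n * (real m + 1) * real K"
proof -
  have N: "N = 2 * 2 ^ (n - 1)" "even N" and N0: "N > 0"
    using n by (cases n; simp add: N_def)+
  define R where "R = range (pattern N)"
  have finR: "finite R" by (rule finite_subset[of _ "Pow {..<N}"]) (auto simp: R_def pattern_def)
  have "R \<noteq> {}" by (simp add: R_def)
  then have K0: "K > 0" using finR by (simp add: K_def R_def card_gt_0_iff)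

  have N_pow: "N ^ c = 2 ^ (n * c)" for c by (simp add: N_def power_mult)
  \<comment> \<open>Chebyshev's bound with \<open>2 * h = N\<close>. It yields \<open>m + 1\<close>
    primes, one more than needed, because 2 is not coprime to \<open>N\<close>.\<close>
  have "2 ^ 2 ^ (n - 1) \<le> N ^ card {p. prime p \<and> p \<le> N}"
    using two_power_le_power_card_primes[of "2 ^ (n - 1)", folded N(1)] by simp
  then have "2 ^ (n - 1) \<le> n * card {p. prime p \<and> p \<le> N}" by (simp add: N_pow)
  then have "n * (m + 1) \<le> n * card {p. prime p \<and> p \<le> N}"
    using nm N(1) by simp
  then have "m + 1 \<le> card {p. prime p \<and> p \<le> N}" using n by (simp only: mult_le_cancel1)
  then have "m \<le> card ({p. prime p \<and> p \<le> N} - {2})"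
    using diff_card_le_card_Diff[of "{2}" "{p. prime p \<and> p \<le> N}"] by simp
  then obtain A where A: "A \<subseteq> {p. prime p \<and> p \<le> N} - {2}" "card A = m" "finite A"
    by (rule obtain_subset_with_card_n)
  have A': "prime p \<and> coprime N p \<and> p \<le> N" if "p \<in> A" for p
  proof -
    have p: "prime p" "p \<le> N" "p \<noteq> 2" using A that by auto
    then have "odd p" using primes_dvd_imp_eq two_is_prime_nat by blast
    then show ?thesis using p by (simp add: N_def)
  qed
  define Y where "Y = \<Prod>A"
  have "(\<Prod>p\<in>A. 2) \<le> Y" unfolding Y_def using A' by (intro prod_mono) (auto simp: prime_ge_2_nat)
  then have mY: "2 ^ m \<le> Y" using A by simp
  have "Y \<le> (\<Prod>p\<in>A. N)" unfolding Y_def using A' by (intro prod_mono) auto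
  then have YN: "Y \<le> N ^ m" using A by simp
  have NY: "N < Y" using Nm mY by simp

  define \<pi> where "\<pi> = card {p. prime p \<and> p \<le> N * Y}"
  \<comment> \<open>Chebyshev's bound again, now with \<open>2 * h = N * Y\<close>.\<close>
  have "2 ^ (2 ^ (n - 1) * Y) \<le> (N * Y) ^ \<pi>"
    using two_power_le_power_card_primes[of "2 ^ (n - 1) * Y", folded mult.assoc, folded N(1)] NY
    by (simp add: \<pi>_def)
  also have "\<dots> \<le> (N * N ^ m) ^ \<pi>" using YN by (intro power_mono) auto
  also have "\<dots> = N ^ (Suc m * \<pi>)" by (simp only: power_Suc power_mult)
  also have "\<dots> = 2 ^ (n * (m + 1) * \<pi>)" by (simp only: N_pow Suc_eq_plus1 mult.assoc)
  finally have pi_ge: "2 ^ (n - 1) * Y \<le> n * (m + 1) * \<pi>" by simp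

  define T where "T u = {v. 1 \<le> v \<and> v < Y \<and> prime (u + N * v) \<and> u + N * v > Y}" for u
  have finT: "finite (T u)" for u by (rule finite_subset[of _ "{..<Y}"]) (auto simp: T_def)
  have cardT: "m * card (T u) \<le> (n + 2) * Y" if u: "u < N" for u
  proof -
    have "(2 ^ m) ^ card (T u) \<le> Y ^ card (T u)" using mY by (intro power_mono) auto
    also have "\<dots> \<le> (4 * 2 ^ n) ^ Y"
      using card_primes_progression[of u n Y] u NY by (simp add: T_def N_def)
    also have "4 * 2 ^ n = (2::nat) ^ (n + 2)" by simp
    finally show ?thesis by (simp only: power_mult[symmetric]) simp
  qed
  define E where "E = Sigma {..<N} T"
  have finE: "finite E" unfolding E_def using finT by auto
  \<comment> \<open>Primes up to \<open>Y\<close>, to which the progression bound does not apply,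
    number at most \<open>Y\<close>. Every other prime up to \<open>N * Y\<close> is encoded by its
    remainder and quotient modulo \<open>N\<close>; the endpoint \<open>N * Y\<close> is even, hence
    not such a prime.\<close>
  have "{p. prime p \<and> p \<le> N * Y} \<subseteq> {1..Y} \<union> (\<lambda>(u, v). u + N * v) ` E"
  proof
    fix p assume "p \<in> {p. prime p \<and> p \<le> N * Y}"
    then have p: "prime p" "p \<le> N * Y" by auto
    show "p \<in> {1..Y} \<union> (\<lambda>(u, v). u + N * v) ` E"
    proof (cases "p \<le> Y")
      case True
      then show ?thesis using p prime_ge_1_nat by auto
    next
      case False
      have "p \<noteq> N * Y"
      proof
        assume "p = N * Y"
        then have "2 dvd p" using N by simp
        then have "p = 2" using p(1) primes_dvd_imp_eq two_is_prime_nat by metis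
        then show False using False NY N0 by simp
      qed
      then have "p div N < Y" using p by (simp add: less_mult_imp_div_less mult.commute)
      moreover have "p div N \<ge> 1" using False NY N0 by (simp add: div_greater_zero_iff Suc_le_eq)
      ultimately have "(p mod N, p div N) \<in> E" using p False N0 by (simp add: E_def T_def)
      then show ?thesis by (intro UnI2 image_eqI[where x = "(p mod N, p div N)"]) auto
    qed
  qed
  then have "\<pi> \<le> card ({1..Y} \<union> (\<lambda>(u, v). u + N * v) ` E)"
    unfolding \<pi>_def using finE by (intro card_mono) auto
  also have "\<dots> \<le> card {1..Y} + card ((\<lambda>(u, v). u + N * v) ` E)" by (rule card_Un_le)
  also have "\<dots> \<le> Y + card E" using card_image_le[OF finE] by simp
  finally have piE: "\<pi> \<le> Y + card E" .

  define EP where "EP P = {(u, v) \<in> E. pattern N v = P}" for P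
  \<comment> \<open>Pigeonhole: \<open>P\<close> is a pattern with the largest number of
    pairs.\<close>
  have "Max ((card \<circ> EP) ` R) \<in> (card \<circ> EP) ` R"
    using finR \<open>R \<noteq> {}\<close> by (intro Max_in) auto
  then obtain P where P: "P \<in> R" "card (EP P) = Max ((card \<circ> EP) ` R)" by auto
  have "E = (\<Union>Q\<in>R. EP Q)" by (auto simp: EP_def R_def)
  then have "card E \<le> (\<Sum>Q\<in>R. card (EP Q))" using card_UN_le[OF finR] by metis
  also have "\<dots> \<le> (\<Sum>Q\<in>R. card (EP P))"
    unfolding P(2) using finR by (intro sum_mono Max_ge) auto
  also have "\<dots> = K * card (EP P)" by (simp add: K_def R_def)
  finally have EK: "card E \<le> K * card (EP P)" .

  define S where "S = {v \<in> {1..<Y}. pattern N v = P}"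
  have PN: "P \<subseteq> {..<N}" using P(1) by (auto simp: R_def pattern_def)
  then have finP: "finite P" using finite_subset by blast
  \<comment> \<open>The pairs of \<open>P\<close> are counted in two ways: by \<open>v\<close>,
    which makes \<open>S\<close> large, and then by \<open>u\<close>, which lies in \<open>P\<close>
    because \<open>v\<close> has pattern \<open>P\<close>, so that \<open>P\<close> is large as
    well.\<close>
  have "EP P \<subseteq> {..<N} \<times> S" by (auto simp: EP_def E_def T_def S_def)
  then have "card (EP P) \<le> card ({..<N} \<times> S)" by (intro card_mono) (auto simp: S_def)
  then have ES: "card (EP P) \<le> N * card S" by (simp add: card_cartesian_product)
  have "EP P \<subseteq> Sigma P T" by (auto simp: EP_def E_def T_def pattern_def)
  then have "card (EP P) \<le> card (Sigma P T)" using finP finT by (intro card_mono) auto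
  also have "\<dots> = (\<Sum>u\<in>P. card (T u))" using finP finT by simp
  finally have "m * card (EP P) \<le> m * (\<Sum>u\<in>P. card (T u))" by simp
  also have "\<dots> = (\<Sum>u\<in>P. m * card (T u))" by (rule sum_distrib_left)
  also have "\<dots> \<le> (\<Sum>u\<in>P. (n + 2) * Y)" using cardT PN by (intro sum_mono) auto
  also have "\<dots> = card P * ((n + 2) * Y)" by simp
  finally have EPP: "m * card (EP P) \<le> card P * ((n + 2) * Y)" .
  have sieve: "real (card S) \<le> real Y * (1 - card P / (2 * real N)) ^ m"
    unfolding A(2)[symmetric]
    by (rule card_sieve_le[OF A(3) A' PN Y_def]) (auto simp: S_def pattern_def)

  \<comment> \<open>By \<open>nm\<close>, the contribution of the primes up to \<open>Y\<close> is
    at most half of \<open>N * Y\<close> and is absorbed on the left.\<close>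
  have "2 * (2 ^ (n - 1) * Y) \<le> 2 * (n * (m + 1) * (Y + K * card (EP P)))"
    using pi_ge piE EK by (meson add_left_mono le_trans mult_le_mono2)
  moreover have "4 * n * (m + 1) * Y \<le> N * Y" using nm by (rule mult_le_mono1)
  ultimately have main: "N * Y \<le> 4 * n * (m + 1) * K * card (EP P)"
    using N(1) by (simp add: algebra_simps)

  define c where "c = 4 * real n * (real m + 1) * real K"
  define k where "k = real (card P) / (2 * real N)"
  have Y0: "Y > 0" using NY by simp
  have "N * Y \<le> 4 * n * (m + 1) * K * (N * card S)"
    using main mult_le_mono2[OF ES] by (rule order_trans)
  then have "N * Y \<le> N * (4 * n * (m + 1) * K * card S)" by (simp only: mult_ac)
  then have "Y \<le> 4 * n * (m + 1) * K * card S" using N0 by (simp only: mult_le_cancel1)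
  then have "real Y \<le> real (4 * n * (m + 1) * K * card S)" by (simp only: of_nat_le_iff)
  also have "\<dots> = c * real (card S)" by (simp add: c_def algebra_simps)
  also have "\<dots> \<le> c * (real Y * (1 - k) ^ m)"
    using sieve by (intro mult_left_mono) (auto simp: k_def c_def)
  finally have "real Y * 1 \<le> real Y * (c * (1 - k) ^ m)" by (simp add: mult_ac)
  then have "1 \<le> c * (1 - k) ^ m" using Y0 by simp
  also have "\<dots> \<le> c * exp (- k) ^ m"
  proof (intro mult_left_mono power_mono)
    show "1 - k \<le> exp (- k)" using exp_ge_add_one_self[of "- k"] by simp
    have "card P \<le> N" using card_mono[OF _ PN] by simp
    then show "0 \<le> 1 - k" using N0 by (simp add: k_def field_simps)
  qed (simp add: c_def)
  also have "exp (- k) ^ m = inverse (exp (real m * k))"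
    by (simp add: exp_of_nat_mult exp_minus power_inverse)
  finally have exp_le: "exp (real m * k) \<le> c" by (simp add: field_simps)

  \<comment> \<open>With \<open>m + 1 \<le> 2 * m\<close> the factor \<open>m\<close> cancels, so
    the lower bound for the density of \<open>P\<close> depends only on \<open>n\<close> and
    \<open>K\<close>.\<close>
  have "m * (N * Y) \<le> (4 * n * (m + 1) * K) * (m * card (EP P))"
    using mult_le_mono2[OF main, of m] by (simp only: mult_ac)
  also have "\<dots> \<le> (4 * n * (m + 1) * K) * (card P * ((n + 2) * Y))"
    using EPP by (rule mult_le_mono2)
  also have "\<dots> \<le> (4 * n * (2 * m) * K) * (card P * ((n + 2) * Y))"
    using m by (intro mult_le_mono) auto
  finally have "(m * Y) * N \<le> (m * Y) * (8 * n * (n + 2) * K * card P)" by (simp only: mult_ac)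
  then have "N \<le> 8 * n * (n + 2) * K * card P" using m Y0 by simp
  then have "real N \<le> real (8 * n * (n + 2) * K * card P)" by (simp only: of_nat_le_iff)
  moreover define d where "d = 16 * real n * (real n + 2) * real K"
  moreover have "real (card P) = 2 * k * real N" using N0 by (simp add: k_def)
  ultimately have "real N * 1 \<le> real N * (d * k)" by (simp add: algebra_simps)
  then have "1 \<le> d * k" using N0 by simp
  then have "real m * 1 \<le> real m * (d * k)" by (intro mult_left_mono) auto
  moreover have "d > 0" using n K0 by (simp add: d_def)
  ultimately have "real m / d \<le> real m * k" by (simp add: field_simps)
  then show ?thesis using exp_le unfolding c_def d_def by (meson exp_le_cancel_iff order_trans)
qed

text \<open>The parameters are \<open>n = 16 * j\<close> and \<open>m = 2^(4 * j)\<close>, the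
  fourth root of \<open>N\<close>. If \<open>K\<close> were at most \<open>2^j\<close>, the exponent
  on the left of \<open>card_patterns_exp_le\<close> would be at least \<open>2^(3 * j)\<close> up
  to a polynomial in \<open>j\<close>, whereas the right side is only about
  \<open>2^(5 * j)\<close>.\<close>

lemma eventually_card_patterns_gt:
  "\<forall>\<^sub>F j in sequentially. 2 ^ j < card (range (pattern (2 ^ (16 * j))))"
proof -
  have "\<forall>\<^sub>F j in sequentially.
      exp (2 ^ (4 * j) / (16 * (16 * real j) * (16 * real j + 2) * 2 ^ j))
      > 4 * (16 * real j) * (2 ^ (4 * j) + 1) * (2::real) ^ j" by real_asymp
  moreover have "\<forall>\<^sub>F j in sequentially. 16 * real j < 2 ^ (4 * j)" by real_asymp
  moreover have "\<forall>\<^sub>F j in sequentially. 4 * (16 * real j) * (2 ^ (4 * j) + 1) \<le> 2 ^ (16 * j)" by real_asymp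
  moreover have "\<forall>\<^sub>F j in sequentially. j > 0" by (rule eventually_gt_at_top)
  ultimately show ?thesis
  proof eventually_elim
    case (elim j)
    let ?K = "card (range (pattern (2 ^ (16 * j))))"
    have "real (16 * j) < real (2 ^ (4 * j))" using elim(2) by simp
    then have "16 * j < 2 ^ (4 * j)" by (simp only: of_nat_less_iff)
    moreover have "real (4 * (16 * j) * (2 ^ (4 * j) + 1)) \<le> real (2 ^ (16 * j))" using elim(3) by (simp add: algebra_simps)
    then have "4 * (16 * j) * (2 ^ (4 * j) + 1) \<le> 2 ^ (16 * j)" by (simp only: of_nat_le_iff)
    ultimately have *: "exp (2 ^ (4 * j) / (16 * (16 * real j) * (16 * real j + 2) * real ?K))
        \<le> 4 * (16 * real j) * (2 ^ (4 * j) + 1) * real ?K"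
      using card_patterns_exp_le[of "16 * j" "2 ^ (4 * j)"] elim(4) by simp
    show ?case
    proof (rule ccontr)
      assume "\<not> 2 ^ j < ?K"
      then have "real ?K \<le> real (2 ^ j)" by (simp only: of_nat_le_iff)
      then have K: "real ?K \<le> 2 ^ j" by simp
      have "finite (range (pattern (2 ^ (16 * j))))"
        by (rule finite_subset[of _ "Pow {..<2 ^ (16 * j)}"]) (auto simp: pattern_def)
      then have K0: "real ?K > 0" by (simp add: card_gt_0_iff)
      have "exp (2 ^ (4 * j) / (16 * (16 * real j) * (16 * real j + 2) * 2 ^ j))
          \<le> exp (2 ^ (4 * j) / (16 * (16 * real j) * (16 * real j + 2) * real ?K))"
        unfolding exp_le_cancel_iff using K K0 elim(4) by (intro divide_left_mono mult_left_mono mult_pos_pos) auto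
      also note *
      also have "4 * (16 * real j) * (2 ^ (4 * j) + 1) * real ?K
          \<le> 4 * (16 * real j) * (2 ^ (4 * j) + 1) * 2 ^ j"
        using K by (intro mult_left_mono) auto
      finally show False using elim(1) by simp
    qed
  qed
qed

theorem theorem7:
  "\<not> (\<exists>f :: nat \<Rightarrow> nat. (\<lambda>n. real (f n)) \<in> o(\<lambda>n. real n) \<and> PRIMES \<in> Alt TYPE('q) f)"
proof
  assume "\<exists>f :: nat \<Rightarrow> nat. (\<lambda>n. real (f n)) \<in> o(\<lambda>n. real n) \<and> PRIMES \<in> Alt TYPE('q) f"
  then obtain f :: "nat \<Rightarrow> nat" and M :: "('q, bool) alt_machine" and C :: real
    where f: "(\<lambda>n. real (f n)) \<in> o(\<lambda>n. real n)" and M: "language M = PRIMES"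
      and fin: "\<And>n. finite (states_upto M n)"
      and states: "\<And>n. real (card (states_upto M n)) \<le> C * real (f n)"
    unfolding Alt_def by blast
  \<comment> \<open>The 16 matches the length \<open>16 * j\<close>, so that at most
    \<open>j\<close> states remain; \<open>\<bar>C\<bar> + 1\<close> is positive whatever the sign
    of \<open>C\<close>.\<close>
  define c where "c = 1 / (16 * (\<bar>C\<bar> + 1))"
  have "\<forall>\<^sub>F n in sequentially. norm (real (f n)) \<le> c * norm (real n)"
    by (rule landau_o.smallD[OF f]) (simp add: c_def add_nonneg_pos)
  then obtain n0 where n0: "\<And>n. n \<ge> n0 \<Longrightarrow> real (f n) \<le> c * real n"
    by (auto simp: eventually_sequentially)
  obtain j0 where j0: "\<And>j. j \<ge> j0 \<Longrightarrow> 2 ^ j < card (range (pattern (2 ^ (16 * j))))"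
    using eventually_card_patterns_gt by (auto simp: eventually_sequentially)
  define j where "j = max n0 j0"
  have "real (card (states_upto M (16 * j))) \<le> C * real (f (16 * j))" by (rule states)
  also have "\<dots> \<le> (\<bar>C\<bar> + 1) * real (f (16 * j))" by (intro mult_right_mono) auto
  also have "\<dots> \<le> (\<bar>C\<bar> + 1) * (c * real (16 * j))" by (intro mult_left_mono n0) (auto simp: j_def)
  also have "\<dots> = real j" by (simp add: c_def add_nonneg_pos field_simps)
  finally have "card (states_upto M (16 * j)) \<le> j" by simp
  then have "(2::nat) ^ card (states_upto M (16 * j)) \<le> 2 ^ j" by (intro power_increasing) auto
  then show False
    using card_patterns_le[OF M fin, of "16 * j"] j0[of j] unfolding j_def by linarith
qed

end
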